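(* Let $g:\mathbb{R}\to\mathbb{R}$ be a concave function. Then the following assertions are equivalent: (i) There exists a separately convex function $f:\mathbb{R}^2\to\mathbb{R}$ such that $f(u,u)=g(u)$ for each $u\in\mathbb{R}$. (ii) The function $$x\;\mapsto\;\int_0^1\frac{g(x+t)+g(x-t)-2g(x)}{t^2}\,dt$$ is locally bounded from below (i.e. bounded from below on every bounded subset of $\mathbb{R}$).
   Context: A function $f:\mathbb{R}^d\to\mathbb{R}$ is called separately convex if it is convex on every line parallel to a coordinate axis. *)

theory Defs
  imports "HOL-Analysis.Analysis"
begin

definition sep_convex :: "(real \<Rightarrow> real \<Rightarrow> real) \<Rightarrow> bool" where
  "sep_convex f \<longleftrightarrow> (\<forall>y. convex_on UNIV (\<lambda>x. f x y)) \<and> (\<forall>x. convex_on UNIV (\<lambda>y. f x y))"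

text \<open>The integral  int_0^1 (g(x+t)+g(x-t)-2g(x))/t^2 dt  as an extended real.
  For concave g the integrand is nonpositive, so the integral is well defined in [-infinity,0];
  we compute it as minus the (nonnegative) Lebesgue integral of the negated integrand.\<close>
definition second_diff_integral :: "(real \<Rightarrow> real) \<Rightarrow> real \<Rightarrow> ereal" where
  "second_diff_integral g x =
     - enn2ereal (\<integral>\<^sup>+ t\<in>{0..1}. ennreal (- ((g (x + t) + g (x - t) - 2 * g x) / t\<^sup>2)) \<partial>lborel)"

end

theory Submission
  imports Defs
begin

text \<open>
  Write \<open>D\<^sub>a(t) = 2 g(a) - g(a + t) - g(a - t)\<close>. By monotonicity of \<open>D\<^sub>a\<close> the integral in (ii) is comparable to
  \<open>- \<Sum>\<^sub>k 2\<^sup>k D\<^sub>a(2\<^sup>-\<^sup>k)\<close>.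

  If \<open>f\<close> is separately convex with trace \<open>g\<close>, then \<open>P(t) = f(a + t, a - t) + f(a - t, a + t) - 2 f(a, a)\<close> satisfies
  \<open>P(t) \<ge> D\<^sub>a(t) \<ge> 0\<close> and \<open>P(2t) \<ge> 2 P(t) + D\<^sub>a(2t)/3\<close>. Telescoping \<open>2\<^sup>k P(2\<^sup>-\<^sup>k)\<close> bounds the dyadic sum by \<open>3 P(1)\<close>, which is
  locally bounded in \<open>a\<close>.

  Conversely, a supremum of separately convex functions is separately convex, so it suffices to find for each \<open>a\<close>
  a separately convex function which touches \<open>g\<close> at \<open>(a, a)\<close>, lies below \<open>g\<close> on the diagonal and is bounded above
  at each point uniformly in \<open>a\<close>. Start with the tangent of \<open>g\<close> at \<open>a\<close>. For \<open>\<bar>u - a\<bar>\<close> of order \<open>2\<^sup>-\<^sup>k\<close> add \<open>D\<^sub>a(2\<^sup>-\<^sup>k)\<close>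
  times a block living at scale \<open>2\<^sup>-\<^sup>k\<close>; the total cost is \<open>\<bar>x - y\<bar>\<close> times the dyadic sum. Far from \<open>a\<close>,
  use translates of the function which is 0 on a quadrant and \<open>- x y\<close> elsewhere.
\<close>

section \<open>Convexity and concavity inequalities on the real line\<close>

lemma convex_on_combination:
  fixes f :: "real \<Rightarrow> real"
  assumes "convex_on UNIV f" "0 \<le> t" "t \<le> 1" "z = (1 - t) * x + t * y"
  shows "f z \<le> (1 - t) * f x + t * f y"
  using convex_onD[OF assms(1), of t x y] assms(2-4) by simp

lemma convex_on_UNIV_realI:
  fixes f :: "real \<Rightarrow> real"
  assumes "\<And>t x y. 0 < t \<Longrightarrow> t < 1 \<Longrightarrow> f ((1 - t) * x + t * y) \<le> (1 - t) * f x + t * f y"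
  shows "convex_on UNIV f"
  by (rule convex_onI) (use assms in auto)

lemma concave_on_combination:
  fixes g :: "real \<Rightarrow> real"
  assumes "concave_on UNIV g" "0 \<le> t" "t \<le> 1" "z = (1 - t) * x + t * y"
  shows "(1 - t) * g x + t * g y \<le> g z"
  using concave_onD[OF assms(1), of t x y] assms(2-4) by simp

lemma concave_on_min_le:
  fixes g :: "real \<Rightarrow> real"
  assumes "concave_on UNIV g" "p \<le> u" "u \<le> q"
  shows "min (g p) (g q) \<le> g u"
proof (cases "p = q")
  case False
  with assms have pq: "p < q" by simp
  define t where "t = (u - p) / (q - p)"
  have t: "0 \<le> t" "t \<le> 1" using assms pq by (auto simp: t_def field_simps)
  have "t * (q - p) = u - p" using pq by (simp add: t_def)
  then have u: "u = (1 - t) * p + t * q" by (simp add: algebra_simps)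
  have "(1 - t) * min (g p) (g q) + t * min (g p) (g q) \<le> (1 - t) * g p + t * g q"
    using t by (intro add_mono mult_left_mono) auto
  also have "\<dots> \<le> g u" by (rule concave_on_combination[OF assms(1) t u])
  finally show ?thesis by (simp add: algebra_simps)
qed (use assms in auto)

lemma concave_on_supergradient:
  fixes g :: "real \<Rightarrow> real"
  assumes "concave_on UNIV g"
  obtains c where "\<And>u. g u \<le> g a + c * (u - a)"
proof -
  define d where "d = Inf ((\<lambda>t. (- g a - - g t) / (a - t)) ` ({a<..} \<inter> UNIV))"
  have "- g a + d * (u - a) \<le> - g u" for u
    using convex_le_Inf_differential[of UNIV "\<lambda>x. - g x" a u] assms
    by (simp add: concave_on_def d_def)
  then have "g u \<le> g a + (- d) * (u - a)" for u by (smt (verit) mult_minus_left)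
  then show ?thesis using that by blast
qed

subsection \<open>Second differences and dyadic sums\<close>

definition second_difference :: "(real \<Rightarrow> real) \<Rightarrow> real \<Rightarrow> real \<Rightarrow> real" where
  "second_difference g a t = 2 * g a - g (a + t) - g (a - t)"

lemma second_difference_nonneg:
  assumes "concave_on UNIV g"
  shows "0 \<le> second_difference g a t"
  using concave_on_combination[OF assms, of "1/2" a "a + t" "a - t"]
  by (simp add: second_difference_def field_simps)

text \<open>In \<open>t\<close> the second difference is convex and vanishes at 0, so shrinking
  \<open>t\<close> by a factor \<open>r\<close> in [0,1] shrinks it at least by \<open>r\<close>;
  nonnegativity then discards \<open>r\<close>.\<close>

lemma second_difference_mono:
  assumes g: "concave_on UNIV g" and "0 \<le> s" "s \<le> t"
  shows "second_difference g a s \<le> second_difference g a t"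
proof (cases "t = 0")
  case False
  with assms have t: "t > 0" by simp
  define r where "r = s / t"
  have r: "0 \<le> r" "r \<le> 1" "s = r * t" using assms t by (auto simp: r_def)
  have "(1 - r) * g a + r * g (a + t) \<le> g (a + s)" "(1 - r) * g a + r * g (a - t) \<le> g (a - s)"
    by (rule concave_on_combination[OF g r(1,2)], simp add: r(3) algebra_simps)+
  then have "second_difference g a s \<le> r * second_difference g a t"
    by (simp add: second_difference_def algebra_simps)
  also have "\<dots> \<le> 1 * second_difference g a t"
    using r second_difference_nonneg[OF g] by (intro mult_right_mono) auto
  finally show ?thesis by simp
qed (use assms in auto)

text \<open>Half-open shells are disjoint and cover (0,1], so the sums of indicators below reduce to
  one term at each point.\<close>

definition dyadic :: "nat \<Rightarrow> real set" where
  "dyadic k = {(1/2) ^ Suc k <.. (1/2) ^ k}"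

lemma dyadic_unique: "t \<in> dyadic j \<Longrightarrow> t \<in> dyadic k \<Longrightarrow> j = k"
proof (induction j k rule: linorder_wlog)
  case (le j k)
  show ?case
  proof (rule ccontr)
    assume "j \<noteq> k"
    then have "Suc j \<le> k" using le by simp
    then have "(1/2::real) ^ k \<le> (1/2) ^ Suc j" by (intro power_decreasing) auto
    then show False using le by (simp add: dyadic_def)
  qed
qed auto

lemma dyadic_exists:
  assumes "0 < t" "t \<le> 1"
  obtains k where "t \<in> dyadic k"
proof -
  obtain n where n: "(1/2::real) ^ n < t" using real_arch_pow_inv[of t "1/2"] assms by auto
  \<comment> \<open>Since \<open>t\<close> is at most 1, the least exponent is positive; its
    predecessor indexes the shell.\<close>
  define m where "m = (LEAST n. (1/2::real) ^ n < t)"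
  have m: "(1/2::real) ^ m < t" unfolding m_def by (rule LeastI, rule n)
  then obtain k where k: "m = Suc k" using assms by (cases m) auto
  have "\<not> (1/2::real) ^ k < t" using not_less_Least[of k "\<lambda>n. (1/2::real) ^ n < t"] k by (simp add: m_def)
  then have "t \<in> dyadic k" using m k by (simp add: dyadic_def)
  then show ?thesis by (rule that)
qed

lemma suminf_dyadic_indicator:
  fixes c :: "nat \<Rightarrow> ennreal"
  assumes "t \<in> dyadic k"
  shows "(\<Sum>j. c j * indicator (dyadic j) t) = c k"
proof -
  have "(\<Sum>j. c j * indicator (dyadic j) t) = (\<Sum>j\<in>{k}. c j * indicator (dyadic j) t)"
    using assms dyadic_unique[of t] by (intro suminf_finite) (auto simp: indicator_def)
  then show ?thesis using assms by simp
qed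

lemma nn_integral_dyadic_step:
  assumes "\<And>k. 0 \<le> c k"
  shows "(\<integral>\<^sup>+t. (\<Sum>k. ennreal (c k) * indicator (dyadic k) t) \<partial>lborel) = (\<Sum>k. ennreal (c k / 2 ^ Suc k))"
proof -
  have [measurable]: "dyadic k \<in> sets borel" for k by (simp add: dyadic_def)
  have e: "emeasure lborel (dyadic k) = ennreal (1 / 2 ^ Suc k)" for k
    by (simp add: dyadic_def power_divide field_simps)
  have "(\<integral>\<^sup>+t. ennreal (c k) * indicator (dyadic k) t \<partial>lborel) = ennreal (c k / 2 ^ Suc k)" for k
  proof -
    have "(\<integral>\<^sup>+t. ennreal (c k) * indicator (dyadic k) t \<partial>lborel) = ennreal (c k) * ennreal (1 / 2 ^ Suc k)"
      by (subst nn_integral_cmult_indicator) (simp_all only: e, simp)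
    also have "\<dots> = ennreal (c k * (1 / 2 ^ Suc k))" by (rule ennreal_mult[symmetric]) (use assms in auto)
    finally show ?thesis by (simp only: times_divide_eq_right mult_1_right)
  qed
  then show ?thesis by (subst nn_integral_suminf) simp_all
qed

abbreviation second_difference_energy :: "(real \<Rightarrow> real) \<Rightarrow> real \<Rightarrow> ennreal" where
  "second_difference_energy g a \<equiv>
     \<integral>\<^sup>+ t\<in>{0..1}. ennreal (- ((g (a + t) + g (a - t) - 2 * g a) / t\<^sup>2)) \<partial>lborel"

lemma second_difference_integrand:
  "- ((g (a + t) + g (a - t) - 2 * g a) / t\<^sup>2) = second_difference g a t / t\<^sup>2"
proof -
  have "second_difference g a t = - (g (a + t) + g (a - t) - 2 * g a)" by (simp add: second_difference_def)
  then show ?thesis by (simp only: divide_minus_left)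
qed

lemma half_power_squared: "((1/2::real) ^ k)\<^sup>2 = (1/4) ^ k"
  by (simp add: power2_eq_square flip: power_mult_distrib)

text \<open>On shell \<open>k\<close> the numerator is at most its value at the right end, and
  \<open>1 / t\<^sup>2\<close> is at most \<open>4 ^ Suc k\<close>. The shell has length
  \<open>1 / 2 ^ Suc k\<close>, which leaves the weight \<open>2 * 2 ^ k\<close>.\<close>

lemma energy_le_dyadic_sum:
  assumes g: "concave_on UNIV g"
  shows "second_difference_energy g a \<le> (\<Sum>k. ennreal (2 * (2 ^ k * second_difference g a ((1/2) ^ k))))"
proof -
  let ?c = "\<lambda>k. second_difference g a ((1/2) ^ k) * 4 ^ Suc k"
  have "second_difference_energy g a \<le> (\<integral>\<^sup>+t. (\<Sum>k. ennreal (?c k) * indicator (dyadic k) t) \<partial>lborel)"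
  proof (rule nn_integral_mono)
    fix t :: real
    show "ennreal (- ((g (a + t) + g (a - t) - 2 * g a) / t\<^sup>2)) * indicator {0..1} t
            \<le> (\<Sum>k. ennreal (?c k) * indicator (dyadic k) t)"
    proof (cases "0 < t \<and> t \<le> 1")
      case True
      then obtain k where k: "t \<in> dyadic k" using dyadic_exists by blast
      then have "((1/2) ^ Suc k)\<^sup>2 \<le> t\<^sup>2" by (intro power_mono) (auto simp: dyadic_def)
      then have t2: "1 / t\<^sup>2 \<le> 4 ^ Suc k"
        using True unfolding half_power_squared by (simp add: power_one_over field_simps del: power_Suc)
      have "second_difference g a t * (1 / t\<^sup>2) \<le> ?c k"
        using k True t2 second_difference_nonneg[OF g]
        by (intro mult_mono second_difference_mono[OF g]) (auto simp: dyadic_def)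
      then show ?thesis
        using True by (simp add: suminf_dyadic_indicator[OF k] second_difference_integrand ennreal_leI)
    next
      case False
      \<comment> \<open>At \<open>t = 0\<close> the integrand is 0; at the other points outside the
        shells the indicator vanishes.\<close>
      then show ?thesis by (cases "t = 0") (auto simp: indicator_def)
    qed
  qed
  also have "\<dots> = (\<Sum>k. ennreal (?c k / 2 ^ Suc k))"
    using second_difference_nonneg[OF g] by (intro nn_integral_dyadic_step) auto
  also have "(\<lambda>k. ?c k / 2 ^ Suc k) = (\<lambda>k. 2 * (2 ^ k * second_difference g a ((1/2) ^ k)))"
  proof
    fix k
    have "(4::real) ^ k = 2 ^ k * 2 ^ k" by (simp flip: power_mult_distrib)
    then show "?c k / 2 ^ Suc k = 2 * (2 ^ k * second_difference g a ((1/2) ^ k))" by simp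
  qed
  finally show ?thesis .
qed

text \<open>The same comparison with the left end of each shell. The scales therefore start at 1/2,
  and the weight is \<open>4 ^ k / 2 ^ Suc k = 2 ^ Suc k / 4\<close>.\<close>

lemma dyadic_sum_le_energy:
  assumes g: "concave_on UNIV g"
  shows "(\<Sum>k. ennreal (2 ^ Suc k * second_difference g a ((1/2) ^ Suc k) / 4)) \<le> second_difference_energy g a"
proof -
  let ?c = "\<lambda>k. second_difference g a ((1/2) ^ Suc k) * 4 ^ k"
  have "(\<lambda>k. 2 ^ Suc k * second_difference g a ((1/2) ^ Suc k) / 4) = (\<lambda>k. ?c k / 2 ^ Suc k)"
  proof
    fix k
    have "(4::real) ^ k = 2 ^ k * 2 ^ k" by (simp flip: power_mult_distrib)
    then show "2 ^ Suc k * second_difference g a ((1/2) ^ Suc k) / 4 = ?c k / 2 ^ Suc k" by simp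
  qed
  then have "(\<Sum>k. ennreal (2 ^ Suc k * second_difference g a ((1/2) ^ Suc k) / 4)) = (\<Sum>k. ennreal (?c k / 2 ^ Suc k))"
    by metis
  also have "\<dots> = (\<integral>\<^sup>+t. (\<Sum>k. ennreal (?c k) * indicator (dyadic k) t) \<partial>lborel)"
    using second_difference_nonneg[OF g] by (intro nn_integral_dyadic_step[symmetric]) auto
  also have "\<dots> \<le> second_difference_energy g a"
  proof (rule nn_integral_mono)
    fix t :: real
    show "(\<Sum>k. ennreal (?c k) * indicator (dyadic k) t)
            \<le> ennreal (- ((g (a + t) + g (a - t) - 2 * g a) / t\<^sup>2)) * indicator {0..1} t"
    proof (cases "0 < t \<and> t \<le> 1")
      case True
      then obtain k where k: "t \<in> dyadic k" using dyadic_exists by blast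
      then have "t\<^sup>2 \<le> ((1/2) ^ k)\<^sup>2" using True by (intro power_mono) (auto simp: dyadic_def)
      then have t2: "4 ^ k \<le> 1 / t\<^sup>2"
        using True unfolding half_power_squared by (simp add: power_one_over field_simps del: power_Suc)
      have "?c k \<le> second_difference g a t * (1 / t\<^sup>2)"
        using k True t2 second_difference_nonneg[OF g]
        by (intro mult_mono second_difference_mono[OF g]) (auto simp: dyadic_def)
      then show ?thesis
        using True by (simp add: suminf_dyadic_indicator[OF k] second_difference_integrand ennreal_leI)
    next
      case False
      have "t \<notin> dyadic k" for k
      proof
        assume "t \<in> dyadic k"
        moreover have "0 < (1/2::real) ^ Suc k" "(1/2::real) ^ k \<le> 1" by (auto simp: power_le_one)
        ultimately show False using False unfolding dyadic_def by (smt (verit) greaterThanAtMost_iff)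
      qed
      then show ?thesis by simp
    qed
  qed
  finally show ?thesis .
qed

lemma second_diff_integral_ge_iff:
  assumes "0 \<le> M"
  shows "ereal (- M) \<le> second_diff_integral g a \<longleftrightarrow> second_difference_energy g a \<le> ennreal M"
proof -
  have "ereal (- M) \<le> - enn2ereal e \<longleftrightarrow> e \<le> ennreal M" for e
  proof -
    have "ereal (- M) \<le> - enn2ereal e \<longleftrightarrow> enn2ereal e \<le> enn2ereal (ennreal M)"
      using assms by (metis enn2ereal_ennreal ereal_minus_le_minus uminus_ereal.simps(1))
    then show ?thesis by (simp add: less_eq_ennreal.rep_eq)
  qed
  then show ?thesis by (simp add: second_diff_integral_def)
qed

subsection \<open>Traces have locally bounded energy\<close>

lemma sep_convexD1:
  assumes "sep_convex f" "0 \<le> t" "t \<le> 1" "z = (1 - t) * x + t * x'"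
  shows "f z y \<le> (1 - t) * f x y + t * f x' y"
  using convex_on_combination[of "\<lambda>x. f x y"] assms by (simp add: sep_convex_def)

lemma sep_convexD2:
  assumes "sep_convex f" "0 \<le> t" "t \<le> 1" "z = (1 - t) * y + t * y'"
  shows "f x z \<le> (1 - t) * f x y + t * f x y'"
  using convex_on_combination[of "\<lambda>y. f x y"] assms by (simp add: sep_convex_def)

lemma convex_on_le_max:
  fixes f :: "real \<Rightarrow> real"
  assumes "convex_on UNIV f" "p \<le> u" "u \<le> q"
  shows "f u \<le> max (f p) (f q)"
  using concave_on_min_le[of "\<lambda>x. - f x" p u q] assms by (auto simp: concave_on_def min_def max_def split: if_splits)

text \<open>A convex function on an interval is largest at an endpoint; used in each variable, this
  moves the maximum to the four corners.\<close>

lemma sep_convex_bounded_above_on_box: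
  assumes f: "sep_convex f"
  obtains C where "\<And>x y. \<bar>x\<bar> \<le> R \<Longrightarrow> \<bar>y\<bar> \<le> R \<Longrightarrow> f x y \<le> C"
proof -
  have 1: "f x y \<le> max (f (- R) y) (f R y)" if "\<bar>x\<bar> \<le> R" for x y
    using convex_on_le_max[of "\<lambda>x. f x y" "- R" x R] f that by (auto simp: sep_convex_def)
  have 2: "f x y \<le> max (f x (- R)) (f x R)" if "\<bar>y\<bar> \<le> R" for x y
    using convex_on_le_max[of "\<lambda>y. f x y" "- R" y R] f that by (auto simp: sep_convex_def)
  show ?thesis
  proof (rule that)
    fix x y assume "\<bar>x\<bar> \<le> R" "\<bar>y\<bar> \<le> R"
    then show "f x y \<le> max (max (f (- R) (- R)) (f (- R) R)) (max (f R (- R)) (f R R))"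
      using 1[of x y] 2[of y "- R"] 2[of y R] by linarith
  qed
qed

definition antidiagonal_difference :: "(real \<Rightarrow> real \<Rightarrow> real) \<Rightarrow> real \<Rightarrow> real \<Rightarrow> real" where
  "antidiagonal_difference f a t = f (a + t) (a - t) + f (a - t) (a + t) - 2 * f a a"

text \<open>Midpoint convexity in \<open>x\<close> and then in \<open>y\<close> bounds
  \<open>4 * f a a\<close> by the sum over the corners of the square of half side \<open>t\<close>
  about \<open>(a, a)\<close>: two lie on the diagonal, two on the antidiagonal.\<close>

lemma second_difference_le_antidiagonal:
  assumes f: "sep_convex f"
  shows "second_difference (\<lambda>u. f u u) a t \<le> antidiagonal_difference f a t"
proof -
  have "f a a \<le> (1 - 1/2) * f (a + t) a + 1/2 * f (a - t) a"
    by (rule sep_convexD1[OF f]) (auto simp: field_simps)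
  moreover have "f (a + t) a \<le> (1 - 1/2) * f (a + t) (a + t) + 1/2 * f (a + t) (a - t)"
    by (rule sep_convexD2[OF f]) (auto simp: field_simps)
  moreover have "f (a - t) a \<le> (1 - 1/2) * f (a - t) (a + t) + 1/2 * f (a - t) (a - t)"
    by (rule sep_convexD2[OF f]) (auto simp: field_simps)
  ultimately show ?thesis
    unfolding second_difference_def antidiagonal_difference_def by simp
qed

text \<open>Extrapolate along the path \<open>(a + t, a - t)\<close>, \<open>(a + 2t, a - t)\<close>, \<open>(a + 2t, a - 2t)\<close>
  using the values on the diagonal, and along its mirror image.\<close>

lemma antidiagonal_difference_double:
  assumes f: "sep_convex f"
  shows "2 * antidiagonal_difference f a t + 2/3 * second_difference (\<lambda>u. f u u) a t
           + 1/3 * second_difference (\<lambda>u. f u u) a (2 * t)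
         \<le> antidiagonal_difference f a (2 * t)"
proof -
  \<comment> \<open>The weights come from the positions of the three points on each segment. Since
    2/3 * 3/4 = 1/2, the outer antidiagonal values enter with factor 1/2, whence the
    doubling.\<close>
  have "f (a + t) (a - t) \<le> (1 - 2/3) * f (a - t) (a - t) + 2/3 * f (a + 2 * t) (a - t)"
    by (rule sep_convexD1[OF f]) (auto simp: field_simps)
  moreover have "f (a - t) (a + t) \<le> (1 - 2/3) * f (a + t) (a + t) + 2/3 * f (a - 2 * t) (a + t)"
    by (rule sep_convexD1[OF f]) (auto simp: field_simps)
  moreover have "f (a + 2 * t) (a - t) \<le> (1 - 3/4) * f (a + 2 * t) (a + 2 * t) + 3/4 * f (a + 2 * t) (a - 2 * t)"
    by (rule sep_convexD2[OF f]) (auto simp: field_simps)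
  moreover have "f (a - 2 * t) (a + t) \<le> (1 - 3/4) * f (a - 2 * t) (a - 2 * t) + 3/4 * f (a - 2 * t) (a + 2 * t)"
    by (rule sep_convexD2[OF f]) (auto simp: field_simps)
  ultimately show ?thesis
    unfolding second_difference_def antidiagonal_difference_def by (simp add: field_simps)
qed

lemma dyadic_sum_le_antidiagonal:
  assumes f: "sep_convex f" and g: "concave_on UNIV (\<lambda>u. f u u)"
  shows "(\<Sum>k<n. 2 ^ k * second_difference (\<lambda>u. f u u) a ((1/2) ^ k)) \<le> 3 * antidiagonal_difference f a 1"
proof -
  let ?P = "\<lambda>k::nat. 2 ^ k * antidiagonal_difference f a ((1/2) ^ k)"
  let ?s = "\<lambda>k::nat. second_difference (\<lambda>u. f u u) a ((1/2) ^ k)"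
  have step: "2 ^ k * ?s k \<le> 3 * (?P k - ?P (Suc k))" for k
  proof -
    have "2 * antidiagonal_difference f a ((1/2) ^ Suc k) + 1/3 * ?s k \<le> antidiagonal_difference f a ((1/2) ^ k)"
      using antidiagonal_difference_double[OF f, of a "(1/2) ^ Suc k"]
        second_difference_nonneg[OF g, of a "(1/2) ^ Suc k"] by simp
    then have "2 ^ k * (2 * antidiagonal_difference f a ((1/2) ^ Suc k) + 1/3 * ?s k)
        \<le> 2 ^ k * antidiagonal_difference f a ((1/2) ^ k)" by (intro mult_left_mono) auto
    then show ?thesis by (simp add: algebra_simps)
  qed
  have "(\<Sum>k<n. 2 ^ k * ?s k) \<le> (\<Sum>k<n. 3 * (?P k - ?P (Suc k)))" by (intro sum_mono step)
  also have "\<dots> = 3 * (?P 0 - ?P n)" by (subst sum_distrib_left[symmetric], subst sum_lessThan_telescope'[of ?P n]) (rule refl)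
  also have "\<dots> \<le> 3 * ?P 0"
    using second_difference_le_antidiagonal[OF f, of a "(1/2) ^ n"] second_difference_nonneg[OF g, of a "(1/2) ^ n"]
    by simp
  finally show ?thesis by simp
qed

lemma energy_le_antidiagonal:
  assumes f: "sep_convex f" and g: "concave_on UNIV (\<lambda>u. f u u)"
  shows "second_difference_energy (\<lambda>u. f u u) a \<le> ennreal (6 * antidiagonal_difference f a 1)"
proof -
  let ?s = "\<lambda>k::nat. 2 ^ k * second_difference (\<lambda>u. f u u) a ((1/2) ^ k)"
  have nn: "0 \<le> ?s k" for k using second_difference_nonneg[OF g] by simp
  have "second_difference_energy (\<lambda>u. f u u) a \<le> (\<Sum>k. ennreal (2 * ?s k))"
    by (rule energy_le_dyadic_sum[OF g])
  also have "\<dots> \<le> ennreal (6 * antidiagonal_difference f a 1)"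
  proof (rule suminf_le_const)
    fix n
    have "(\<Sum>k<n. ennreal (2 * ?s k)) = ennreal (\<Sum>k<n. 2 * ?s k)" using nn by (intro sum_ennreal) simp
    also have "\<dots> \<le> ennreal (6 * antidiagonal_difference f a 1)"
      using dyadic_sum_le_antidiagonal[OF f g, where n = n and a = a] by (intro ennreal_leI) (simp flip: sum_distrib_left)
    finally show "(\<Sum>k<n. ennreal (2 * ?s k)) \<le> ennreal (6 * antidiagonal_difference f a 1)" .
  qed auto
  finally show ?thesis .
qed

proposition second_diff_integral_bounded_below_of_trace:
  assumes f: "sep_convex f" and g: "concave_on UNIV (\<lambda>u. f u u)" and S: "bounded S"
  shows "\<exists>M. \<forall>a\<in>S. ereal M \<le> second_diff_integral (\<lambda>u. f u u) a"
proof -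
  obtain R where R: "\<And>a. a \<in> S \<Longrightarrow> \<bar>a\<bar> \<le> R" using S by (auto simp: bounded_iff)
  obtain C where C: "\<And>x y. \<bar>x\<bar> \<le> R + 1 \<Longrightarrow> \<bar>y\<bar> \<le> R + 1 \<Longrightarrow> f x y \<le> C"
    using sep_convex_bounded_above_on_box[OF f] by blast
  define m where "m = min (f (- R) (- R)) (f R R)"
  \<comment> \<open>Here \<open>m\<close> bounds the trace below on [-R, R] by concavity, and
    \<open>12 * C - 12 * m\<close> is \<open>6 * (C + C - 2 * m)\<close>.\<close>
  define M where "M = max 0 (12 * C - 12 * m)"
  show ?thesis
  proof (intro exI ballI)
    fix a assume "a \<in> S"
    then have a: "\<bar>a\<bar> \<le> R" by (rule R)
    have "m \<le> f a a" using concave_on_min_le[OF g, of "- R" a R] a by (simp add: m_def)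
    moreover have "f (a + 1) (a - 1) \<le> C" "f (a - 1) (a + 1) \<le> C" using a by (auto intro!: C)
    ultimately have "6 * antidiagonal_difference f a 1 \<le> M" by (simp add: antidiagonal_difference_def M_def)
    then have "second_difference_energy (\<lambda>u. f u u) a \<le> ennreal M"
      using energy_le_antidiagonal[OF f g, of a] by (meson ennreal_leI order_trans)
    then show "ereal (- M) \<le> second_diff_integral (\<lambda>u. f u u) a"
      by (subst second_diff_integral_ge_iff) (auto simp: M_def)
  qed
qed

subsection \<open>Separately convex building blocks\<close>

lemma sep_convex_add: "sep_convex f \<Longrightarrow> sep_convex h \<Longrightarrow> sep_convex (\<lambda>x y. f x y + h x y)"
  by (auto simp: sep_convex_def)

lemma sep_convex_cmul: "0 \<le> c \<Longrightarrow> sep_convex f \<Longrightarrow> sep_convex (\<lambda>x y. c * f x y)"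
  by (auto simp: sep_convex_def)

lemma sep_convex_affine: "sep_convex (\<lambda>x y. \<alpha> + \<beta> * x + \<beta> * y)"
  unfolding sep_convex_def by (auto intro!: convex_on_UNIV_realI simp: algebra_simps)

lemma convex_on_UNIV_compose_affine:
  fixes f :: "real \<Rightarrow> real"
  assumes "convex_on UNIV f"
  shows "convex_on UNIV (\<lambda>x. f (\<alpha> * x + \<beta>))"
  by (rule convex_on_UNIV_realI, rule convex_on_combination[OF assms]) (auto simp: algebra_simps)

lemma sep_convex_compose_affine:
  "sep_convex f \<Longrightarrow> sep_convex (\<lambda>x y. f (\<alpha> * x + \<beta>) (\<alpha> * y + \<beta>))"
  unfolding sep_convex_def by (auto intro: convex_on_UNIV_compose_affine)

lemma convex_on_UNIV_max:
  fixes f h :: "real \<Rightarrow> real"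
  assumes "convex_on UNIV f" "convex_on UNIV h"
  shows "convex_on UNIV (\<lambda>x. max (f x) (h x))"
proof (rule convex_on_UNIV_realI)
  fix t x y :: real assume t: "0 < t" "t < 1"
  have "f ((1 - t) * x + t * y) \<le> (1 - t) * f x + t * f y" "h ((1 - t) * x + t * y) \<le> (1 - t) * h x + t * h y"
    using t by (auto intro!: convex_on_combination[OF assms(1)] convex_on_combination[OF assms(2)])
  moreover have "(1 - t) * f x + t * f y \<le> (1 - t) * max (f x) (h x) + t * max (f y) (h y)"
    "(1 - t) * h x + t * h y \<le> (1 - t) * max (f x) (h x) + t * max (f y) (h y)"
    using t by (auto intro!: add_mono mult_left_mono)
  ultimately show "max (f ((1 - t) * x + t * y)) (h ((1 - t) * x + t * y))
      \<le> (1 - t) * max (f x) (h x) + t * max (f y) (h y)" by linarith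
qed

lemma sep_convex_max: "sep_convex f \<Longrightarrow> sep_convex h \<Longrightarrow> sep_convex (\<lambda>x y. max (f x y) (h x y))"
  unfolding sep_convex_def by (auto intro: convex_on_UNIV_max)

lemma sep_convex_symmetricI:
  assumes "\<And>y. convex_on UNIV (\<lambda>x. f x y)" "\<And>x y. f x y = f y x"
  shows "sep_convex f"
  using assms unfolding sep_convex_def by (metis (no_types, lifting) ext)

lemma convex_on_UNIV_suminf:
  fixes F :: "nat \<Rightarrow> real \<Rightarrow> real"
  assumes F: "\<And>n. convex_on UNIV (F n)" and S: "\<And>x. summable (\<lambda>n. F n x)"
  shows "convex_on UNIV (\<lambda>x. \<Sum>n. F n x)"
proof (rule convex_on_UNIV_realI)
  fix t x y :: real assume t: "0 < t" "t < 1"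
  have "(\<Sum>n. F n ((1 - t) * x + t * y)) \<le> (\<Sum>n. (1 - t) * F n x + t * F n y)"
    using t by (intro suminf_le S summable_add summable_mult convex_on_combination[OF F]) auto
  also have "\<dots> = (1 - t) * (\<Sum>n. F n x) + t * (\<Sum>n. F n y)"
    by (simp add: suminf_add suminf_mult summable_mult S flip: suminf_add)
  finally show "(\<Sum>n. F n ((1 - t) * x + t * y)) \<le> (1 - t) * (\<Sum>n. F n x) + t * (\<Sum>n. F n y)" .
qed

lemma sep_convex_suminf:
  assumes "\<And>n. sep_convex (F n)" "\<And>x y. summable (\<lambda>n. F n x y)"
  shows "sep_convex (\<lambda>x y. \<Sum>n. F n x y)"
  using assms unfolding sep_convex_def by (auto intro!: convex_on_UNIV_suminf)

lemma convex_on_UNIV_SUP: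
  fixes F :: "'i \<Rightarrow> real \<Rightarrow> real"
  assumes F: "\<And>i. i \<in> I \<Longrightarrow> convex_on UNIV (F i)" and I: "I \<noteq> {}"
    and B: "\<And>x. bdd_above ((\<lambda>i. F i x) ` I)"
  shows "convex_on UNIV (\<lambda>x. SUP i\<in>I. F i x)"
proof (rule convex_on_UNIV_realI)
  fix t x y :: real assume t: "0 < t" "t < 1"
  show "(SUP i\<in>I. F i ((1 - t) * x + t * y)) \<le> (1 - t) * (SUP i\<in>I. F i x) + t * (SUP i\<in>I. F i y)"
  proof (rule cSUP_least[OF I])
    fix i assume i: "i \<in> I"
    have "F i ((1 - t) * x + t * y) \<le> (1 - t) * F i x + t * F i y"
      using t by (intro convex_on_combination[OF F[OF i]]) auto
    also have "\<dots> \<le> (1 - t) * (SUP i\<in>I. F i x) + t * (SUP i\<in>I. F i y)"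
      using t by (intro add_mono mult_left_mono cSUP_upper[OF i B]) auto
    finally show "F i ((1 - t) * x + t * y) \<le> (1 - t) * (SUP i\<in>I. F i x) + t * (SUP i\<in>I. F i y)" .
  qed
qed

lemma sep_convex_SUP:
  assumes "\<And>i. i \<in> I \<Longrightarrow> sep_convex (F i)" "I \<noteq> {}" "\<And>x y. bdd_above ((\<lambda>i. F i x y) ` I)"
  shows "sep_convex (\<lambda>x y. SUP i\<in>I. F i x y)"
  using assms unfolding sep_convex_def by (auto intro!: convex_on_UNIV_SUP)

text \<open>Its trace is \<open>- u\<^sup>2\<close> for \<open>u > 0\<close> although it vanishes on a whole quadrant, so translates of it can
  push the trace down arbitrarily far out without affecting a given bounded set.\<close>

definition quadrant_block :: "real \<Rightarrow> real \<Rightarrow> real" where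
  "quadrant_block x y = (if x \<le> 0 \<and> y \<le> 0 then 0 else - (x * y))"

text \<open>On a horizontal line the block is linear if \<open>y > 0\<close>, and otherwise the
  maximum of 0 and a linear function.\<close>

lemma sep_convex_quadrant_block: "sep_convex quadrant_block"
proof (rule sep_convex_symmetricI)
  fix y :: real
  have lin: "convex_on UNIV (\<lambda>x. - (x * y))" by (intro convex_on_UNIV_realI) (simp add: algebra_simps)
  show "convex_on UNIV (\<lambda>x. quadrant_block x y)"
  proof (cases "y \<le> 0")
    case True
    then have "(\<lambda>x. quadrant_block x y) = (\<lambda>x. max 0 (- (x * y)))"
      by (auto simp: quadrant_block_def fun_eq_iff max_def mult_le_0_iff zero_le_mult_iff)
    then show ?thesis using convex_on_UNIV_max[OF _ lin, of "\<lambda>x. 0"] by (simp add: convex_on_const)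
  next
    case False
    then show ?thesis using lin by (simp add: quadrant_block_def)
  qed
qed (simp add: quadrant_block_def)

lemma quadrant_block_diag: "quadrant_block u u = (if u \<le> 0 then 0 else - u\<^sup>2)"
  by (simp add: quadrant_block_def power2_eq_square)

lemma quadrant_block_diag_nonpos: "quadrant_block u u \<le> 0"
  by (simp add: quadrant_block_diag)

text \<open>The bound depends only on \<open>x - y\<close>, so it holds uniformly for all translates
  along the diagonal.\<close>

lemma quadrant_block_le: "quadrant_block x y \<le> (x - y)\<^sup>2"
proof -
  have "(x - y)\<^sup>2 + x * y = (x - y / 2)\<^sup>2 + 3/4 * y\<^sup>2" by (simp add: power2_eq_square algebra_simps)
  then have "- (x * y) \<le> (x - y)\<^sup>2" using zero_le_power2[of "x - y / 2"] zero_le_power2[of y] by linarith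
  then show ?thesis by (simp add: quadrant_block_def)
qed

text \<open>Block \<open>n\<close> vanishes for \<open>x, y \<le> n\<close>, so the sum is locally
  finite and the coefficients may grow arbitrarily fast.\<close>

definition quadrant_series :: "(nat \<Rightarrow> real) \<Rightarrow> real \<Rightarrow> real \<Rightarrow> real" where
  "quadrant_series d x y = (\<Sum>n. d n * quadrant_block (x - n) (y - n))"

lemma quadrant_series_eq_sum:
  fixes x y :: real and N :: nat
  assumes "x \<le> N" "y \<le> N"
  shows "quadrant_series d x y = (\<Sum>n<N. d n * quadrant_block (x - n) (y - n))"
  unfolding quadrant_series_def
  using assms by (intro suminf_finite) (auto simp: quadrant_block_def)

lemma quadrant_series_eq_0: "x \<le> 0 \<Longrightarrow> y \<le> 0 \<Longrightarrow> quadrant_series d x y = 0"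
  using quadrant_series_eq_sum[of x 0 y] by simp

lemma summable_quadrant_series: "summable (\<lambda>n. d n * quadrant_block (x - real n) (y - real n))"
proof (rule summable_finite)
  show "finite {..<nat \<lceil>max x y\<rceil>}" by simp
  show "d n * quadrant_block (x - real n) (y - real n) = 0" if "n \<notin> {..<nat \<lceil>max x y\<rceil>}" for n
    using that by (auto simp: quadrant_block_def not_less nat_le_iff ceiling_le_iff)
qed

lemma sep_convex_quadrant_series:
  fixes d :: "nat \<Rightarrow> real"
  assumes "\<And>n. 0 \<le> d n"
  shows "sep_convex (quadrant_series d)"
  unfolding quadrant_series_def
proof (intro sep_convex_suminf summable_quadrant_series sep_convex_cmul assms)
  show "sep_convex (\<lambda>x y. quadrant_block (x - real n) (y - real n))" for n
    using sep_convex_compose_affine[OF sep_convex_quadrant_block, of 1 "- real n"] by simp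
qed

lemma quadrant_series_diag_le:
  fixes d :: "nat \<Rightarrow> real" and u :: real
  assumes "\<And>n. 0 \<le> d n"
  shows "quadrant_series d u u \<le> d n * quadrant_block (u - n) (u - n)"
proof -
  have "(\<Sum>k\<in>{n}. - (d k * quadrant_block (u - k) (u - k))) \<le> (\<Sum>k. - (d k * quadrant_block (u - k) (u - k)))"
    using assms quadrant_block_diag_nonpos
    by (intro sum_le_suminf summable_minus summable_quadrant_series) (auto simp: mult_nonneg_nonpos)
  then show ?thesis by (simp add: quadrant_series_def suminf_minus summable_quadrant_series)
qed

lemma quadrant_series_diag_nonpos:
  fixes d :: "nat \<Rightarrow> real" and u :: real
  assumes "\<And>n. 0 \<le> d n"
  shows "quadrant_series d u u \<le> 0"
  using quadrant_series_diag_le[of d u 0, OF assms] assms[of 0] quadrant_block_diag_nonpos[of "u - 0"]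
  by (simp add: mult_nonneg_nonpos order_trans)

lemma quadrant_series_diag_le_neg:
  fixes d :: "nat \<Rightarrow> real" and u :: real
  assumes "\<And>n. 0 \<le> d n" "1/2 \<le> u"
  obtains n where "u \<le> real n + 2" "quadrant_series d u u \<le> - d n / 4"
proof -
  \<comment> \<open>This puts \<open>u - n\<close> in [1/2, 3/2): block \<open>n\<close> is already
    at most -1/4 there, and \<open>n + 2\<close> still lies beyond \<open>u\<close>.\<close>
  define n where "n = nat \<lfloor>u - 1/2\<rfloor>"
  have n: "real n = of_int \<lfloor>u - 1/2\<rfloor>" using assms by (simp add: n_def)
  have v: "1/2 \<le> u - n" "u \<le> real n + 2" unfolding n by linarith+
  have "quadrant_series d u u \<le> d n * quadrant_block (u - n) (u - n)"
    by (rule quadrant_series_diag_le[OF assms(1)])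
  also have "\<dots> = - (d n * (u - n)\<^sup>2)" using v by (simp add: quadrant_block_diag)
  also have "\<dots> \<le> - (d n * (1/2)\<^sup>2)" using v assms(1) by (intro le_imp_neg_le mult_left_mono power_mono) auto
  finally show ?thesis using v by (intro that[of n]) (simp_all add: power2_eq_square)
qed

text \<open>A dip of depth 1 at unit scale which costs only linear growth in \<open>\<bar>x - y\<bar>\<close>. The slope 8 is large enough
  for the maximum to be attained by the first term on every axis-parallel line meeting the open square
  as soon as that line leaves it, so the case distinction does not destroy convexity.\<close>

definition scale_block :: "real \<Rightarrow> real \<Rightarrow> real" where
  "scale_block x y = (if \<bar>x\<bar> < 1 \<and> \<bar>y\<bar> < 1 then max (8 * \<bar>x - y\<bar> - 1) (- 4 * (x * y)) else 8 * \<bar>x - y\<bar> - 1)"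

text \<open>By symmetry let \<open>x \<ge> 1\<close>. Either \<open>x * y \<ge> 1/4\<close> and the
  left side is at most -1, or \<open>y \<le> x / 4\<close> and the right side is at least
  \<open>6 * x - 1\<close>, which exceeds \<open>4 * x\<close>. Hence on lines with
  \<open>\<bar>y\<bar> < 1\<close> the block equals the maximum everywhere.\<close>

lemma scale_block_outside:
  fixes x y :: real
  assumes x: "1 \<le> \<bar>x\<bar>" and y: "\<bar>y\<bar> < 1"
  shows "- 4 * (x * y) \<le> 8 * \<bar>x - y\<bar> - 1"
proof -
  have pos: "- 4 * (x * y) \<le> 8 * \<bar>x - y\<bar> - 1" if x: "1 \<le> x" and y: "\<bar>y\<bar> < 1" for x y :: real
  proof (cases "1/4 \<le> x * y")
    case False
    have "y \<le> x / 4"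
    proof (rule ccontr)
      assume "\<not> y \<le> x / 4"
      then have "x * (x / 4) \<le> x * y" using x by (intro mult_left_mono) auto
      moreover have "1 * 1 \<le> x * x" using x by (intro mult_mono) auto
      ultimately show False using False by simp
    qed
    moreover have "x * (- y) \<le> x * 1" using x y by (intro mult_left_mono) auto
    ultimately show ?thesis using x by simp
  next
    case True
    then have "- 4 * (x * y) \<le> - 1" by simp
    also have "\<dots> \<le> 8 * \<bar>x - y\<bar> - 1" by simp
    finally show ?thesis .
  qed
  show ?thesis
  proof (cases "0 \<le> x")
    case True
    then show ?thesis using pos[of x y] x y by simp
  next
    case False
    then show ?thesis using pos[of "- x" "- y"] x y by (simp add: abs_minus_commute)
  qed
qed

lemma sep_convex_scale_block: "sep_convex scale_block"
proof (rule sep_convex_symmetricI)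
  fix y :: real
  have lin: "convex_on UNIV (\<lambda>x. - 4 * (x * y))" by (intro convex_on_UNIV_realI) (simp add: algebra_simps)
  have "convex_on UNIV (\<lambda>x. \<bar>x\<bar> :: real)"
    using convex_on_dist[of UNIV "0::real"] by (simp add: dist_real_def)
  then have abs: "convex_on UNIV (\<lambda>x. 8 * \<bar>x - y\<bar> - 1)"
    using convex_on_add[OF convex_on_cmul[OF _ convex_on_UNIV_compose_affine[of abs 1 "- y"], of 8], of "\<lambda>x. -1"]
    by (simp add: convex_on_const)
  show "convex_on UNIV (\<lambda>x. scale_block x y)"
  proof (cases "\<bar>y\<bar> < 1")
    case True
    have "scale_block x y = max (8 * \<bar>x - y\<bar> - 1) (- 4 * (x * y))" for x
    proof (cases "\<bar>x\<bar> < 1")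
      case False
      then show ?thesis using True scale_block_outside[of x y] by (simp add: scale_block_def max_def)
    qed (use True in \<open>simp add: scale_block_def\<close>)
    then show ?thesis using convex_on_UNIV_max[OF abs lin] by presburger
  next
    case False
    then show ?thesis using abs by (simp add: scale_block_def)
  qed
qed (simp add: scale_block_def abs_minus_commute mult.commute)

text \<open>Only opposite signs of \<open>x\<close> and \<open>y\<close> matter for the product
  term; then \<open>\<bar>y\<bar> \<le> \<bar>x - y\<bar>\<close>, and
  \<open>\<bar>x\<bar> < 1\<close> makes it linear.\<close>

lemma scale_block_le: "scale_block x y \<le> 8 * \<bar>x - y\<bar>"
proof -
  have "- 4 * (x * y) \<le> 8 * \<bar>x - y\<bar>" if x: "\<bar>x\<bar> < 1"
  proof (cases "0 \<le> x * y")
    case False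
    then have "\<bar>y\<bar> \<le> \<bar>x - y\<bar>" by (smt (verit) mult_nonneg_nonneg mult_nonpos_nonpos)
    moreover have "\<bar>x\<bar> * \<bar>y\<bar> \<le> 1 * \<bar>y\<bar>" using x by (intro mult_right_mono) auto
    ultimately show ?thesis using False by (simp add: abs_mult[symmetric])
  next
    case True
    then have "- 4 * (x * y) \<le> 0" by simp
    also have "\<dots> \<le> 8 * \<bar>x - y\<bar>" by simp
    finally show ?thesis .
  qed
  then show ?thesis by (auto simp: scale_block_def)
qed

lemma scale_block_ge: "8 * \<bar>x - y\<bar> - 1 \<le> scale_block x y"
  by (simp add: scale_block_def)

lemma scale_block_diag_nonpos: "scale_block u u \<le> 0"
  using scale_block_le[of u u] by simp

text \<open>The factor 4 in the block makes \<open>- 4 * u\<^sup>2\<close> reach -1 at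
  \<open>\<bar>u\<bar> = 1/2\<close>, so each block has full depth on a whole dyadic range.\<close>

lemma scale_block_diag:
  assumes "1/2 \<le> \<bar>u\<bar>"
  shows "scale_block u u = - 1"
proof -
  have "(1/2) * (1/2) \<le> \<bar>u\<bar> * \<bar>u\<bar>" using assms by (intro mult_mono) auto
  then show ?thesis by (simp add: scale_block_def max_def)
qed

lemma scale_block_0: "scale_block 0 0 = 0"
  by (simp add: scale_block_def)

text \<open>The constant 1 is absorbed into \<open>2 ^ k\<close> to match the weights of
  \<open>dyadic_summable\<close>.\<close>

lemma abs_scale_block_scaled_le:
  "\<bar>scale_block (2 ^ k * (x - a)) (2 ^ k * (y - a))\<bar> \<le> 2 ^ k * (1 + 8 * \<bar>x - y\<bar>)"
proof -
  have d: "\<bar>2 ^ k * (x - a) - 2 ^ k * (y - a)\<bar> = 2 ^ k * \<bar>x - y\<bar>"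
    by (simp add: abs_mult flip: right_diff_distrib)
  have "scale_block (2 ^ k * (x - a)) (2 ^ k * (y - a)) \<le> 8 * (2 ^ k * \<bar>x - y\<bar>)"
    using scale_block_le[of "2 ^ k * (x - a)" "2 ^ k * (y - a)"] unfolding d .
  moreover have "8 * (2 ^ k * \<bar>x - y\<bar>) - 1 \<le> scale_block (2 ^ k * (x - a)) (2 ^ k * (y - a))"
    using scale_block_ge[of "2 ^ k * (x - a)" "2 ^ k * (y - a)"] unfolding d .
  moreover have "(1::real) \<le> 2 ^ k" "0 \<le> 2 ^ k * \<bar>x - y\<bar>" by simp_all
  moreover have "2 ^ k * (1 + 8 * \<bar>x - y\<bar>) = 2 ^ k + 8 * (2 ^ k * \<bar>x - y\<bar>)" by (simp add: algebra_simps)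
  ultimately show ?thesis by linarith
qed

subsection \<open>Extension of a concave function\<close>

text \<open>Divergent series have no meaningful sum here, so finiteness is stated separately by
  \<open>dyadic_summable\<close>.\<close>

definition dyadic_energy :: "(real \<Rightarrow> real) \<Rightarrow> real \<Rightarrow> real" where
  "dyadic_energy g a = (\<Sum>k. 2 ^ Suc k * second_difference g a ((1/2) ^ Suc k))"

definition dyadic_summable :: "(real \<Rightarrow> real) \<Rightarrow> real \<Rightarrow> bool" where
  "dyadic_summable g a \<longleftrightarrow> summable (\<lambda>k. 2 ^ Suc k * second_difference g a ((1/2) ^ Suc k))"

text \<open>The situation after subtracting a tangent at 0. Only contact points
  \<open>a \<ge> 0\<close> are treated, where the slopes \<open>c a\<close> can be chosen
  nonpositive; the other half-line follows by reflection.\<close>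

locale normalized_trace =
  fixes g c :: "real \<Rightarrow> real"
  assumes concave: "concave_on UNIV g"
    and g_0: "g 0 = 0"
    and g_nonpos: "g u \<le> 0"
    and c_nonpos: "0 \<le> a \<Longrightarrow> c a \<le> 0"
    and tangent: "0 \<le> a \<Longrightarrow> g u \<le> g a + c a * (u - a)"
    and summable: "0 \<le> a \<Longrightarrow> dyadic_summable g a"
    and energy_locally_bounded: "\<exists>M. \<forall>a\<in>{0..R}. dyadic_energy g a \<le> M"
begin

lemma g_antimono: "0 \<le> u \<Longrightarrow> u \<le> v \<Longrightarrow> g v \<le> g u"
  using concave_on_min_le[OF concave, of 0 u v] g_0 g_nonpos[of v] by simp

lemma g_mono: "u \<le> v \<Longrightarrow> v \<le> 0 \<Longrightarrow> g u \<le> g v"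
  using concave_on_min_le[OF concave, of u v 0] g_0 g_nonpos[of u] by simp

lemma neg_c_le: "0 \<le> a \<Longrightarrow> - c a \<le> - g (a + 1)"
  using tangent[of a "a + 1"] g_nonpos[of a] by simp

lemma dyadic_energy_nonneg: "0 \<le> a \<Longrightarrow> 0 \<le> dyadic_energy g a"
  using summable second_difference_nonneg[OF concave]
  unfolding dyadic_energy_def dyadic_summable_def by (intro suminf_nonneg) auto

section \<open>Correction of the tangent near the contact point\<close>

definition fine_part :: "real \<Rightarrow> real \<Rightarrow> real \<Rightarrow> real" where
  "fine_part a x y = (\<Sum>k. second_difference g a ((1/2) ^ Suc k) *
                           scale_block (2 ^ Suc k * (x - a)) (2 ^ Suc k * (y - a)))"

lemma summable_fine_part:
  assumes "0 \<le> a"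
  shows "summable (\<lambda>k. second_difference g a ((1/2) ^ Suc k) *
                       scale_block (2 ^ Suc k * (x - a)) (2 ^ Suc k * (y - a)))"
proof (rule summable_comparison_test')
  show "summable (\<lambda>k. 2 ^ Suc k * second_difference g a ((1/2) ^ Suc k) * (1 + 8 * \<bar>x - y\<bar>))"
    using summable[OF assms] unfolding dyadic_summable_def by (rule summable_mult2)
  fix k :: nat
  have "norm (second_difference g a ((1/2) ^ Suc k) * scale_block (2 ^ Suc k * (x - a)) (2 ^ Suc k * (y - a)))
      = second_difference g a ((1/2) ^ Suc k) * \<bar>scale_block (2 ^ Suc k * (x - a)) (2 ^ Suc k * (y - a))\<bar>"
    using second_difference_nonneg[OF concave] by (simp add: abs_mult)
  also have "\<dots> \<le> second_difference g a ((1/2) ^ Suc k) * (2 ^ Suc k * (1 + 8 * \<bar>x - y\<bar>))"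
    using second_difference_nonneg[OF concave] by (intro mult_left_mono abs_scale_block_scaled_le)
  finally show "norm (second_difference g a ((1/2) ^ Suc k) * scale_block (2 ^ Suc k * (x - a)) (2 ^ Suc k * (y - a)))
      \<le> 2 ^ Suc k * second_difference g a ((1/2) ^ Suc k) * (1 + 8 * \<bar>x - y\<bar>)"
    by (simp only: ac_simps)
qed

lemma sep_convex_fine_part:
  assumes "0 \<le> a"
  shows "sep_convex (fine_part a)"
  unfolding fine_part_def
proof (intro sep_convex_suminf summable_fine_part[OF assms] sep_convex_cmul second_difference_nonneg[OF concave])
  show "sep_convex (\<lambda>x y. scale_block (2 ^ Suc k * (x - a)) (2 ^ Suc k * (y - a)))" for k
    using sep_convex_compose_affine[OF sep_convex_scale_block, of "2 ^ Suc k" "- (2 ^ Suc k * a)"]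
    by (simp add: algebra_simps)
qed

lemma fine_part_le:
  assumes "0 \<le> a"
  shows "fine_part a x y \<le> 8 * dyadic_energy g a * \<bar>x - y\<bar>"
proof -
  have "fine_part a x y \<le> (\<Sum>k. 2 ^ Suc k * second_difference g a ((1/2) ^ Suc k) * (8 * \<bar>x - y\<bar>))"
    unfolding fine_part_def
  proof (rule suminf_le[OF _ summable_fine_part[OF assms]])
    fix k :: nat
    have d: "\<bar>2 ^ Suc k * (x - a) - 2 ^ Suc k * (y - a)\<bar> = 2 ^ Suc k * \<bar>x - y\<bar>"
      by (simp add: abs_mult flip: right_diff_distrib)
    have "scale_block (2 ^ Suc k * (x - a)) (2 ^ Suc k * (y - a)) \<le> 8 * (2 ^ Suc k * \<bar>x - y\<bar>)"
      using scale_block_le[of "2 ^ Suc k * (x - a)" "2 ^ Suc k * (y - a)"] unfolding d .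
    then have "second_difference g a ((1/2) ^ Suc k) * scale_block (2 ^ Suc k * (x - a)) (2 ^ Suc k * (y - a))
        \<le> second_difference g a ((1/2) ^ Suc k) * (8 * (2 ^ Suc k * \<bar>x - y\<bar>))"
      using second_difference_nonneg[OF concave] by (intro mult_left_mono)
    then show "second_difference g a ((1/2) ^ Suc k) * scale_block (2 ^ Suc k * (x - a)) (2 ^ Suc k * (y - a))
        \<le> 2 ^ Suc k * second_difference g a ((1/2) ^ Suc k) * (8 * \<bar>x - y\<bar>)"
      by (simp only: ac_simps)
  next
    show "summable (\<lambda>k. 2 ^ Suc k * second_difference g a ((1/2) ^ Suc k) * (8 * \<bar>x - y\<bar>))"
      using summable[OF assms] unfolding dyadic_summable_def by (rule summable_mult2)
  qed
  also have "\<dots> = dyadic_energy g a * (8 * \<bar>x - y\<bar>)"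
    using summable[OF assms] unfolding dyadic_summable_def dyadic_energy_def by (rule suminf_mult2[symmetric])
  finally show ?thesis by (simp add: ac_simps)
qed

lemma fine_part_diag_nonpos: "0 \<le> a \<Longrightarrow> fine_part a u u \<le> 0"
  using fine_part_le[of a u u] by simp

text \<open>All terms are nonpositive on the diagonal, so one suffices: the \<open>k\<close> for
  which \<open>2 ^ Suc k * \<bar>u - a\<bar>\<close> lies in [1/2, 1]. Its block equals -1 and its
  coefficient dominates by monotonicity. The shell is that of \<open>2 * \<bar>u - a\<bar>\<close>
  because the scales start at 1/2.\<close>

lemma fine_part_diag_le:
  assumes a: "0 \<le> a" and v: "0 < \<bar>u - a\<bar>" "\<bar>u - a\<bar> \<le> 1/2"
  shows "fine_part a u u \<le> - second_difference g a (u - a)"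
proof -
  let ?F = "\<lambda>k. second_difference g a ((1/2) ^ Suc k) * scale_block (2 ^ Suc k * (u - a)) (2 ^ Suc k * (u - a))"
  obtain k where "2 * \<bar>u - a\<bar> \<in> dyadic k" using dyadic_exists[of "2 * \<bar>u - a\<bar>"] v by auto
  then have k: "(1/2) ^ Suc k / 2 \<le> \<bar>u - a\<bar>" "\<bar>u - a\<bar> \<le> (1/2) ^ Suc k" by (auto simp: dyadic_def)
  have "2 ^ Suc k * ((1/2) ^ Suc k / 2) \<le> 2 ^ Suc k * \<bar>u - a\<bar>"
    by (intro mult_left_mono k) simp
  then have "1/2 \<le> \<bar>2 ^ Suc k * (u - a)\<bar>"
    by (simp add: abs_mult power_one_over del: power_Suc)
  then have "?F k = - second_difference g a ((1/2) ^ Suc k)" by (simp only: scale_block_diag mult_minus1_right)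
  moreover have "fine_part a u u \<le> ?F k"
  proof -
    have "(\<Sum>j\<in>{k}. - ?F j) \<le> (\<Sum>j. - ?F j)"
      using second_difference_nonneg[OF concave] scale_block_diag_nonpos
      by (intro sum_le_suminf summable_minus summable_fine_part[OF a]) (auto simp: mult_nonneg_nonpos)
    then show ?thesis using suminf_minus[OF summable_fine_part[OF a, of u u]] by (simp add: fine_part_def)
  qed
  moreover have "second_difference g a (u - a) = second_difference g a \<bar>u - a\<bar>"
    by (simp add: second_difference_def abs_if)
  moreover have "second_difference g a \<bar>u - a\<bar> \<le> second_difference g a ((1/2) ^ Suc k)"
    using k by (intro second_difference_mono[OF concave]) auto
  ultimately show ?thesis by linarith
qed

section \<open>Corrections far from the contact point\<close>

definition upper_tail :: "real \<Rightarrow> real \<Rightarrow> real \<Rightarrow> real" where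
  "upper_tail a x y = quadrant_series (\<lambda>n. - 4 * g (a + n + 2)) (x - a) (y - a)"

text \<open>Anchored at 0 instead of \<open>a\<close>: the same function serves every
  \<open>a\<close> and does not endanger finiteness of the supremum.\<close>

definition lower_tail :: "real \<Rightarrow> real \<Rightarrow> real" where
  "lower_tail x y = quadrant_series (\<lambda>n. - 4 * g (- (real n + 2))) (- x) (- y)"

lemma tail_coeff_nonneg: "0 \<le> - 4 * g u"
  using g_nonpos[of u] by simp

lemma sep_convex_upper_tail: "sep_convex (upper_tail a)"
  using sep_convex_compose_affine[OF sep_convex_quadrant_series[of "\<lambda>n. - 4 * g (a + n + 2)"], of 1 "- a"]
    tail_coeff_nonneg by (simp add: upper_tail_def[abs_def])

lemma sep_convex_lower_tail: "sep_convex lower_tail"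
  using sep_convex_compose_affine[OF sep_convex_quadrant_series[of "\<lambda>n. - 4 * g (- (real n + 2))"], of "-1" 0]
    tail_coeff_nonneg by (simp add: lower_tail_def[abs_def])

lemma upper_tail_diag_nonpos: "upper_tail a u u \<le> 0"
  unfolding upper_tail_def by (rule quadrant_series_diag_nonpos) (rule tail_coeff_nonneg)

lemma lower_tail_diag_nonpos: "lower_tail u u \<le> 0"
  unfolding lower_tail_def by (rule quadrant_series_diag_nonpos) (rule tail_coeff_nonneg)

text \<open>The factor 4 in the coefficients cancels the 1/4 from
  \<open>quadrant_series_diag_le_neg\<close>, and \<open>g\<close> decreases from \<open>u\<close>
  to \<open>a + n + 2\<close>.\<close>

lemma upper_tail_diag_le:
  assumes "0 \<le> a" "a + 1/2 \<le> u"
  shows "upper_tail a u u \<le> g u"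
proof -
  obtain n where n: "u - a \<le> real n + 2" "upper_tail a u u \<le> - (- 4 * g (a + n + 2)) / 4"
    unfolding upper_tail_def
    using quadrant_series_diag_le_neg[of "\<lambda>n. - 4 * g (a + n + 2)" "u - a"] tail_coeff_nonneg assms by auto
  have "g (a + n + 2) \<le> g u" using n assms by (intro g_antimono) auto
  then show ?thesis using n by simp
qed

lemma lower_tail_diag_le:
  assumes "u \<le> - 1/2"
  shows "lower_tail u u \<le> g u"
proof -
  obtain n where n: "- u \<le> real n + 2" "lower_tail u u \<le> - (- 4 * g (- (real n + 2))) / 4"
    unfolding lower_tail_def
    using quadrant_series_diag_le_neg[of "\<lambda>n. - 4 * g (- (real n + 2))" "- u"] tail_coeff_nonneg assms by auto
  have "g (- (real n + 2)) \<le> g u" using n assms by (intro g_mono) auto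
  then show ?thesis using n by simp
qed

section \<open>Support functions touching the trace at one point\<close>

text \<open>The terms \<open>- c a\<close> and \<open>dyadic_energy g a\<close> make the quadrant block dominate the tangent and the fine part
  on \<open>x, y \<le> a - 1\<close>, which keeps the supremum over all \<open>a\<close> finite; the last two terms make it dominate
  \<open>- g\<close> on \<open>[- 1, a]\<close>.\<close>

definition steepness :: "real \<Rightarrow> real" where
  "steepness a = 8 * (- c a + dyadic_energy g a - g (- 1) - g a)"

text \<open>On the diagonal the fine part acts within 1/2 of \<open>a\<close>, the upper tail above
  \<open>a + 1/2\<close>, the quadrant block below \<open>a - 1/2\<close>, aided by the lower tail
  below -1/2. All corrections vanish at \<open>(a, a)\<close>.\<close>

definition support_function :: "real \<Rightarrow> real \<Rightarrow> real \<Rightarrow> real" where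
  "support_function a x y = g a + c a * ((x + y) / 2 - a) + fine_part a x y
     + steepness a * quadrant_block (a - x) (a - y) + upper_tail a x y + lower_tail x y"

lemma steepness_nonneg: "0 \<le> a \<Longrightarrow> 0 \<le> steepness a"
  using c_nonpos[of a] dyadic_energy_nonneg[of a] g_nonpos[of "-1"] g_nonpos[of a] by (simp add: steepness_def)

lemma sep_convex_support_function:
  assumes a: "0 \<le> a"
  shows "sep_convex (support_function a)"
proof -
  have tangent: "sep_convex (\<lambda>x y. g a + c a * ((x + y) / 2 - a))"
    using sep_convex_affine[of "g a - c a * a" "c a / 2"] by (simp add: field_simps)
  have quadrant: "sep_convex (\<lambda>x y. quadrant_block (a - x) (a - y))"
    using sep_convex_compose_affine[OF sep_convex_quadrant_block, of "- 1" a] by simp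
  show ?thesis
    unfolding support_function_def[abs_def]
    by (rule sep_convex_add[OF sep_convex_add[OF sep_convex_add[OF sep_convex_add[OF tangent
            sep_convex_fine_part[OF a]] sep_convex_cmul[OF steepness_nonneg[OF a] quadrant]]
            sep_convex_upper_tail] sep_convex_lower_tail])
qed

lemma support_function_touches:
  assumes "0 \<le> a"
  shows "support_function a a a = g a"
  using assms
  by (simp add: support_function_def fine_part_def scale_block_0 quadrant_block_def upper_tail_def
      lower_tail_def quadrant_series_eq_0)

lemma support_function_diag_le:
  assumes a: "0 \<le> a"
  shows "support_function a u u \<le> g u"
proof -
  have nonpos: "steepness a * quadrant_block (a - u) (a - u) \<le> 0"
    using steepness_nonneg[OF a] quadrant_block_diag_nonpos by (simp add: mult_nonneg_nonpos)
  note parts = nonpos fine_part_diag_nonpos[OF a, of u] upper_tail_diag_nonpos[of a u] lower_tail_diag_nonpos[of u]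
  have eq: "support_function a u u = g a + c a * (u - a) + fine_part a u u
     + steepness a * quadrant_block (a - u) (a - u) + upper_tail a u u + lower_tail u u"
    by (simp add: support_function_def)
  consider "u = a" | "0 < \<bar>u - a\<bar>" "\<bar>u - a\<bar> \<le> 1/2" | "a + 1/2 \<le> u" | "u \<le> a - 1/2" by linarith
  then show ?thesis
  proof cases
    case 1
    then show ?thesis using support_function_touches[OF a] by simp
  next
    case 2
    \<comment> \<open>Tangent minus second difference is \<open>g u\<close> plus the error
      \<open>g (2 * a - u) - (g a - c a * (u - a))\<close> at the reflected point, which is
      nonpositive.\<close>
    have "fine_part a u u \<le> - second_difference g a (u - a)" using 2 by (rule fine_part_diag_le[OF a])
    moreover have "g (a - (u - a)) \<le> g a - c a * (u - a)"
      using tangent[OF a, of "a - (u - a)"] by (simp add: algebra_simps)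
    ultimately show ?thesis using parts unfolding eq second_difference_def by simp
  next
    case 3
    have "c a * (u - a) \<le> 0" using c_nonpos[OF a] 3 by (intro mult_nonpos_nonneg) auto
    then show ?thesis using parts g_nonpos[of a] upper_tail_diag_le[OF a 3] unfolding eq by simp
  next
    case 4
    define v where "v = a - u"
    have v: "1/2 \<le> v" using 4 by (simp add: v_def)
    have v2: "v / 2 \<le> v\<^sup>2" using mult_right_mono[OF v, of v] v by (simp add: power2_eq_square)
    have q: "quadrant_block (a - u) (a - u) = - v\<^sup>2" using v by (simp add: quadrant_block_diag v_def)
    \<comment> \<open>By concavity \<open>K\<close> bounds \<open>- g\<close> on [-1, a]. As
      \<open>v \<ge> 1/2\<close>, the quadrant term gains at least
      \<open>4 * (- c a + K) * v\<close>, enough to pay for both the tangent and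
      \<open>K\<close>.\<close>
    define K where "K = - g (- 1) - g a"
    have K: "0 \<le> K" using g_nonpos[of "-1"] g_nonpos[of a] by (simp add: K_def)
    have "8 * (- c a + K) * (v / 2) \<le> steepness a * v\<^sup>2"
      using dyadic_energy_nonneg[OF a] c_nonpos[OF a] K v v2
      by (intro mult_mono) (auto simp: steepness_def K_def)
    moreover have "- c a * v \<ge> 0" using c_nonpos[OF a] v by (simp add: mult_nonpos_nonneg)
    moreover have "K * (1/2) \<le> K * v" by (intro mult_left_mono v K)
    moreover have "8 * (- c a + K) * (v / 2) = 4 * (- c a * v) + 4 * (K * v)" by (simp add: algebra_simps)
    ultimately have st: "- c a * v + K \<le> steepness a * v\<^sup>2" using K by linarith
    have cv: "c a * (u - a) = - c a * v" by (simp add: v_def algebra_simps)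
    show ?thesis
    proof (cases "u \<le> - 1/2")
      case True
      then show ?thesis using parts lower_tail_diag_le[OF True] st K g_nonpos[of a] unfolding eq q cv by simp
    next
      case False
      have "min (g (- 1)) (g a) \<le> g u" using False 4 by (intro concave_on_min_le[OF concave]) auto
      then have "- K \<le> g u" using g_nonpos[of "-1"] g_nonpos[of a] by (simp add: K_def min_def split: if_splits)
      then show ?thesis using parts st g_nonpos[of a] unfolding eq q cv by simp
    qed
  qed
qed

text \<open>Both \<open>a - x\<close> and \<open>a - y\<close> are at least 1, so their product is
  at least the larger one, \<open>r\<close>; tangent and fine part grow at most linearly in
  \<open>r\<close>. The remaining bound is independent of \<open>a\<close>.\<close>

lemma support_function_le_far:
  assumes a: "0 \<le> a" and x: "x \<le> a - 1" and y: "y \<le> a - 1"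
  shows "support_function a x y \<le> lower_tail x y"
proof -
  define r where "r = a - min x y"
  have r: "1 \<le> r" using x by (simp add: r_def)
  have "- c a * (a - (x + y) / 2) \<le> - c a * r"
    using c_nonpos[OF a] by (intro mult_left_mono) (auto simp: r_def)
  moreover have "fine_part a x y \<le> 8 * dyadic_energy g a * r"
  proof -
    have "8 * dyadic_energy g a * \<bar>x - y\<bar> \<le> 8 * dyadic_energy g a * r"
      using dyadic_energy_nonneg[OF a] x y by (intro mult_left_mono) (auto simp: r_def)
    then show ?thesis using fine_part_le[OF a, of x y] by linarith
  qed
  moreover have "(- c a + 8 * dyadic_energy g a) * r \<le> steepness a * ((a - x) * (a - y))"
  proof (rule mult_mono)
    have "1 * r \<le> (a - x) * (a - y)"
    proof (cases "x \<le> y")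
      case True
      then have "r * 1 \<le> (a - x) * (a - y)" using x y by (intro mult_mono) (auto simp: r_def)
      then show ?thesis by simp
    qed (use x y in \<open>intro mult_mono, auto simp: r_def\<close>)
    then show "r \<le> (a - x) * (a - y)" by simp
    show "- c a + 8 * dyadic_energy g a \<le> steepness a"
      using c_nonpos[OF a] g_nonpos[of "-1"] g_nonpos[of a] by (simp add: steepness_def)
  qed (use r steepness_nonneg[OF a] in auto)
  moreover have "upper_tail a x y = 0"
    using x y by (simp add: upper_tail_def quadrant_series_eq_0)
  moreover have "steepness a * quadrant_block (a - x) (a - y) = - (steepness a * ((a - x) * (a - y)))"
    using x by (simp add: quadrant_block_def)
  moreover have "(- c a + 8 * dyadic_energy g a) * r = - c a * r + 8 * dyadic_energy g a * r"
    by (simp add: algebra_simps)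
  moreover have "c a * ((x + y) / 2 - a) = - c a * (a - (x + y) / 2)" by (simp add: right_diff_distrib)
  ultimately show ?thesis using g_nonpos[of a] unfolding support_function_def by linarith
qed

lemma upper_tail_le:
  fixes a R x y :: real and N :: nat
  assumes "0 \<le> a" "a \<le> R" "x - a \<le> real N" "y - a \<le> real N"
  shows "upper_tail a x y \<le> (\<Sum>n<N. - 4 * g (R + n + 2) * (x - y)\<^sup>2)"
proof -
  have "upper_tail a x y = (\<Sum>n<N. - 4 * g (a + n + 2) * quadrant_block (x - a - n) (y - a - n))"
    unfolding upper_tail_def using assms by (intro quadrant_series_eq_sum)
  also have "\<dots> \<le> (\<Sum>n<N. - 4 * g (R + n + 2) * (x - y)\<^sup>2)"
  proof (rule sum_mono)
    fix n :: nat
    have "- 4 * g (a + n + 2) * quadrant_block (x - a - n) (y - a - n) \<le> - 4 * g (a + n + 2) * (x - y)\<^sup>2"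
      using quadrant_block_le[of "x - a - n" "y - a - n"] tail_coeff_nonneg by (intro mult_left_mono) auto
    also have "\<dots> \<le> - 4 * g (R + n + 2) * (x - y)\<^sup>2"
      using g_antimono[of "a + n + 2" "R + n + 2"] assms by (intro mult_right_mono) auto
    finally show "- 4 * g (a + n + 2) * quadrant_block (x - a - n) (y - a - n) \<le> - 4 * g (R + n + 2) * (x - y)\<^sup>2" .
  qed
  finally show ?thesis .
qed

text \<open>For \<open>a > R\<close> the far estimate applies. For \<open>a\<close> in [0, R] the
  slopes, energies and tail coefficients have bounds depending only on \<open>R\<close>, and the
  blocks have bounds depending only on \<open>x - y\<close>.\<close>

lemma support_function_bdd_above: "bdd_above ((\<lambda>a. support_function a x y) ` {0..})"
proof -
  define R where "R = \<bar>x\<bar> + \<bar>y\<bar> + 1"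
  obtain M where M: "\<And>a. 0 \<le> a \<Longrightarrow> a \<le> R \<Longrightarrow> dyadic_energy g a \<le> M"
    using energy_locally_bounded[of R] by (metis atLeastAtMost_iff)
  obtain N :: nat where N: "R \<le> real N" using real_arch_simple by blast
  define G where "G = - g (R + 1)"
  have G: "0 \<le> G" using g_nonpos by (simp add: G_def)
  have M0: "0 \<le> M" using M[of 0] dyadic_energy_nonneg[of 0] by (simp add: R_def)
  define K where "K = G * (2 * R) + 8 * M * \<bar>x - y\<bar> + 8 * (G + M - g (- 1) + G) * (x - y)\<^sup>2
      + (\<Sum>n<N. - 4 * g (R + n + 2) * (x - y)\<^sup>2)"
  have "support_function a x y \<le> max 0 K + lower_tail x y" if a: "0 \<le> a" for a
  proof (cases "a \<le> R")
    case False
    then have "x \<le> a - 1" "y \<le> a - 1" by (auto simp: R_def)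
    then show ?thesis using support_function_le_far[OF a, of x y] by simp
  next
    case True
    have cG: "- c a \<le> G" using neg_c_le[OF a] g_antimono[of "a + 1" "R + 1"] a True by (simp add: G_def)
    have gG: "- g a \<le> G" using g_antimono[of a "R + 1"] a True by (simp add: G_def)
    have "c a * ((x + y) / 2 - a) = - c a * (a - (x + y) / 2)" by (simp add: right_diff_distrib)
    also have "\<dots> \<le> - c a * (2 * R)"
      using c_nonpos[OF a] True by (intro mult_left_mono) (auto simp: R_def field_simps)
    also have "\<dots> \<le> G * (2 * R)" using cG by (intro mult_right_mono) (auto simp: R_def)
    finally have 1: "c a * ((x + y) / 2 - a) \<le> G * (2 * R)" .
    have "8 * dyadic_energy g a * \<bar>x - y\<bar> \<le> 8 * M * \<bar>x - y\<bar>"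
      using M[OF a True] by (intro mult_right_mono) auto
    then have 2: "fine_part a x y \<le> 8 * M * \<bar>x - y\<bar>" using fine_part_le[OF a, of x y] by linarith
    have "steepness a * quadrant_block (a - x) (a - y) \<le> steepness a * (x - y)\<^sup>2"
      using quadrant_block_le[of "a - x" "a - y"] steepness_nonneg[OF a]
      by (intro mult_left_mono) (simp_all add: power2_commute)
    also have "\<dots> \<le> 8 * (G + M - g (- 1) + G) * (x - y)\<^sup>2"
      using cG gG M[OF a True] by (intro mult_right_mono) (auto simp: steepness_def)
    finally have 3: "steepness a * quadrant_block (a - x) (a - y) \<le> 8 * (G + M - g (- 1) + G) * (x - y)\<^sup>2" .
    have 4: "upper_tail a x y \<le> (\<Sum>n<N. - 4 * g (R + n + 2) * (x - y)\<^sup>2)"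
      using a True N by (intro upper_tail_le) (auto simp: R_def)
    have "support_function a x y \<le> K + lower_tail x y"
      using 1 2 3 4 g_nonpos[of a] unfolding support_function_def K_def by linarith
    then show ?thesis by linarith
  qed
  then show ?thesis by (intro bdd_aboveI2) auto
qed

lemma half_line_extension:
  obtains f where "sep_convex f" "\<And>u. f u u \<le> g u" "\<And>u. 0 \<le> u \<Longrightarrow> f u u = g u"
proof -
  define f where "f x y = (SUP a\<in>{0..}. support_function a x y)" for x y
  have "sep_convex f" unfolding f_def[abs_def]
    by (rule sep_convex_SUP) (auto intro: sep_convex_support_function support_function_bdd_above)
  moreover have le: "f u u \<le> g u" for u
    unfolding f_def by (rule cSUP_least) (auto intro: support_function_diag_le)
  moreover have "f u u = g u" if "0 \<le> u" for u
  proof (rule antisym[OF le])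
    have "support_function u u u \<le> f u u"
      unfolding f_def using that by (intro cSUP_upper support_function_bdd_above) auto
    then show "g u \<le> f u u" using support_function_touches[OF that] by simp
  qed
  ultimately show ?thesis using that by blast
qed

end

section \<open>Normalization and gluing of the two half-lines\<close>

lemma energy_le_imp_dyadic:
  assumes g: "concave_on UNIV g" and M: "0 \<le> M" "second_difference_energy g a \<le> ennreal M"
  shows "dyadic_summable g a" "dyadic_energy g a \<le> 4 * M"
proof -
  let ?s = "\<lambda>k. 2 ^ Suc k * second_difference g a ((1/2) ^ Suc k) / 4"
  have nn: "0 \<le> ?s k" for k using second_difference_nonneg[OF g] by simp
  have le: "(\<Sum>k. ennreal (?s k)) \<le> ennreal M" using dyadic_sum_le_energy[OF g, of a] M(2) by (rule order_trans)
  have s: "summable ?s"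
  proof (rule summable_suminf_not_top[OF nn])
    show "(\<Sum>k. ennreal (?s k)) \<noteq> top" using le by (auto simp: top_unique)
  qed
  have eq: "4 * ?s k = 2 ^ Suc k * second_difference g a ((1/2) ^ Suc k)" for k by simp
  show "dyadic_summable g a" using summable_mult[OF s, of 4] unfolding dyadic_summable_def eq .
  have "ennreal (\<Sum>k. ?s k) \<le> ennreal M" using le suminf_ennreal2[OF nn s] by simp
  then have "(\<Sum>k. ?s k) \<le> M" using M(1) by (simp only: ennreal_le_iff)
  moreover have "dyadic_energy g a = 4 * (\<Sum>k. ?s k)"
    unfolding dyadic_energy_def using suminf_mult[OF s, of 4] unfolding eq .
  ultimately show "dyadic_energy g a \<le> 4 * M" by simp
qed

lemma half_line_extension_of_energy_bound:
  assumes g: "concave_on UNIV g" "g 0 = 0" "\<And>u. g u \<le> 0"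
    and bound: "\<And>R. \<exists>M\<ge>0. \<forall>a. \<bar>a\<bar> \<le> R \<longrightarrow> second_difference_energy g a \<le> ennreal M"
  obtains f where "sep_convex f" "\<And>u. f u u \<le> g u" "\<And>u. 0 \<le> u \<Longrightarrow> f u u = g u"
proof -
  \<comment> \<open>At \<open>a = 0\<close> the slope 0 works since \<open>g\<close> has its maximum
    there; for \<open>a > 0\<close>, testing a supergradient at 0 gives
    \<open>c * a \<le> g a \<le> 0\<close>.\<close>
  have "\<exists>c\<le>0. \<forall>u. g u \<le> g a + c * (u - a)" if "0 \<le> a" for a
  proof (cases "a = 0")
    case True
    then show ?thesis using g by (intro exI[of _ 0]) simp
  next
    case False
    obtain c where c: "\<And>u. g u \<le> g a + c * (u - a)" using concave_on_supergradient[OF g(1)] by blast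
    have "c * a \<le> 0" using c[of 0] g(2) g(3)[of a] by simp
    then have "c \<le> 0" using that False by (simp add: mult_le_0_iff)
    then show ?thesis using c by blast
  qed
  then obtain c where c: "\<And>a. 0 \<le> a \<Longrightarrow> c a \<le> 0" "\<And>a u. 0 \<le> a \<Longrightarrow> g u \<le> g a + c a * (u - a)"
    by metis
  interpret normalized_trace g c
  proof
    show "dyadic_summable g a" for a using bound[of "\<bar>a\<bar>"] energy_le_imp_dyadic(1)[OF g(1)] by blast
    show "\<exists>M. \<forall>a\<in>{0..R}. dyadic_energy g a \<le> M" for R
    proof -
      obtain M where M: "0 \<le> M" "\<And>a. \<bar>a\<bar> \<le> R \<Longrightarrow> second_difference_energy g a \<le> ennreal M"
        using bound[of R] by blast
      then have "dyadic_energy g a \<le> 4 * M" if "a \<in> {0..R}" for a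
        using that by (intro energy_le_imp_dyadic(2)[OF g(1)]) auto
      then show ?thesis by blast
    qed
  qed (use g c in auto)
  show ?thesis using half_line_extension that by blast
qed

text \<open>Subtracting a tangent at 0 leaves second differences unchanged. The half-line extensions
  of the normalized function and of its reflection both stay below it on the diagonal, and each is
  exact on its half, so their maximum is exact everywhere.\<close>

proposition trace_of_second_diff_integral_bounded_below:
  assumes g: "concave_on UNIV g"
    and bound: "\<And>S. bounded S \<Longrightarrow> \<exists>M. \<forall>a\<in>S. ereal M \<le> second_diff_integral g a"
  shows "\<exists>f. sep_convex f \<and> (\<forall>u. f u u = g u)"
proof -
  have energy: "\<exists>M\<ge>0. \<forall>a. \<bar>a\<bar> \<le> R \<longrightarrow> second_difference_energy g a \<le> ennreal M" for R
  proof -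
    obtain M where "\<forall>a\<in>{- R..R}. ereal M \<le> second_diff_integral g a"
      using bound[of "{- R..R}"] by auto
    then have M: "ereal M \<le> second_diff_integral g a" if "\<bar>a\<bar> \<le> R" for a
      using that by (simp add: abs_le_iff)
    show ?thesis
    proof (intro exI[of _ "max 0 (- M)"] conjI allI impI)
      fix a assume "\<bar>a\<bar> \<le> R"
      then have "ereal M \<le> second_diff_integral g a" by (rule M)
      moreover have "ereal (- max 0 (- M)) \<le> ereal M" by simp
      ultimately show "second_difference_energy g a \<le> ennreal (max 0 (- M))"
        using second_diff_integral_ge_iff[of "max 0 (- M)" g a] by (meson max.cobounded1 order_trans)
    qed simp
  qed
  obtain c where c: "\<And>u. g u \<le> g 0 + c * (u - 0)" using concave_on_supergradient[OF g] by blast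
  define h where "h u = g u - g 0 - c * u" for u
  have lin: "concave_on UNIV (\<lambda>u. - g 0 - c * u)"
    unfolding concave_on_def by (rule convex_on_UNIV_realI) (simp add: algebra_simps)
  have h: "concave_on UNIV h"
    using concave_on_add[OF g lin] by (simp add: h_def[abs_def] algebra_simps)
  have h': "concave_on UNIV (\<lambda>u. h (- u))"
    using convex_on_UNIV_compose_affine[of "\<lambda>u. - h u" "-1" 0] h by (simp add: concave_on_def)
  have h0: "h 0 = 0" "h u \<le> 0" for u using c[of u] by (simp_all add: h_def)
  have "second_difference_energy h a = second_difference_energy g a" for a
  proof -
    have "h (a + t) + h (a - t) - 2 * h a = g (a + t) + g (a - t) - 2 * g a" for t
      by (simp add: h_def algebra_simps)
    then show ?thesis by (simp only:)
  qed
  then have bh: "\<exists>M\<ge>0. \<forall>a. \<bar>a\<bar> \<le> R \<longrightarrow> second_difference_energy h a \<le> ennreal M" for R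
    using energy by simp
  have reflect: "second_difference_energy (\<lambda>u. h (- u)) a = second_difference_energy h (- a)" for a
  proof -
    have "h (- (a + t)) + h (- (a - t)) - 2 * h (- a) = h (- a + t) + h (- a - t) - 2 * h (- a)" for t
    proof -
      have "- (a + t) = - a - t" "- (a - t) = - a + t" by simp_all
      then show ?thesis by simp
    qed
    then show ?thesis by (simp only:)
  qed
  have bh': "\<exists>M\<ge>0. \<forall>a. \<bar>a\<bar> \<le> R \<longrightarrow> second_difference_energy (\<lambda>u. h (- u)) a \<le> ennreal M" for R
  proof -
    obtain M where M: "0 \<le> M" "\<And>a. \<bar>a\<bar> \<le> R \<Longrightarrow> second_difference_energy h a \<le> ennreal M"
      using bh[of R] by blast
    show ?thesis unfolding reflect by (intro exI[of _ M] conjI allI impI M) simp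
  qed
  obtain p where p: "sep_convex p" "\<And>u. p u u \<le> h u" "\<And>u. 0 \<le> u \<Longrightarrow> p u u = h u"
    using half_line_extension_of_energy_bound[OF h h0 bh] by blast
  obtain q where q: "sep_convex q" "\<And>u. q u u \<le> h (- u)" "\<And>u. 0 \<le> u \<Longrightarrow> q u u = h (- u)"
    using half_line_extension_of_energy_bound[OF h' _ _ bh'] h0 by auto
  \<comment> \<open>Splitting the slope \<open>c\<close> evenly between the variables restores the
    tangent on the diagonal.\<close>
  define f where "f x y = max (p x y) (q (- x) (- y)) + (g 0 + c / 2 * x + c / 2 * y)" for x y
  have "sep_convex (\<lambda>x y. q (- x) (- y))" using sep_convex_compose_affine[OF q(1), of "-1" 0] by simp
  then have "sep_convex f"
    unfolding f_def[abs_def] by (intro sep_convex_add sep_convex_max sep_convex_affine p(1))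
  moreover have "f u u = g u" for u
  proof -
    have "max (p u u) (q (- u) (- u)) = h u"
      using p(2)[of u] q(2)[of "- u"] p(3)[of u] q(3)[of "- u"] by (cases "0 \<le> u") auto
    then show ?thesis by (simp add: f_def h_def)
  qed
  ultimately show ?thesis by blast
qed

theorem theorem1p1:
  fixes g :: "real \<Rightarrow> real"
  assumes "concave_on UNIV g"
  shows "(\<exists>f :: real \<Rightarrow> real \<Rightarrow> real. sep_convex f \<and> (\<forall>u. f u u = g u))
     \<longleftrightarrow> (\<forall>S :: real set. bounded S \<longrightarrow>
            (\<exists>M :: real. \<forall>x\<in>S. ereal M \<le> second_diff_integral g x))"
proof
  assume "\<exists>f. sep_convex f \<and> (\<forall>u. f u u = g u)"
  then obtain f where f: "sep_convex f" "(\<lambda>u. f u u) = g" by auto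
  then show "\<forall>S. bounded S \<longrightarrow> (\<exists>M. \<forall>x\<in>S. ereal M \<le> second_diff_integral g x)"
    using second_diff_integral_bounded_below_of_trace[OF f(1)] assms by auto
next
  assume "\<forall>S. bounded S \<longrightarrow> (\<exists>M. \<forall>x\<in>S. ereal M \<le> second_diff_integral g x)"
  then show "\<exists>f. sep_convex f \<and> (\<forall>u. f u u = g u)"
    using trace_of_second_diff_integral_bounded_below[OF assms] by blast
qed

end
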